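(* Let $G=(V,E,S)$ be a multigraph with $m$ edges and $k$ special vertices. Then there is a partition $V=V_1\cup V_2$ such that, for $i=1,2$, $$e(V_i)+f(V_i)\le \frac{m}{3}+\frac{k+1}{2}.$$
   Context: A multigraph with special vertices $G=(V,E,S)$ consists of a finite vertex set $V$, a multiset $E$ of edges, each an unordered pair of distinct vertices (repeated edges allowed), with $m=|E|$ counted with multiplicity, and a set $S\subseteq V$ of special vertices with $|S|=k$. For $W\subseteq V$, $e(W)$ is the number of edges (with multiplicity) with both endpoints in $W$, and $f(W)=|W\cap S|$ is the number of special vertices in $W$. A partition $V=V_1\cup V_2$ means $V_1,V_2$ are disjoint with union $V$. *)

theory Defs
  imports Complex_Main "HOL-Library.Multiset"
begin

text \<open>
  An edge is the two-element set of its end vertices, so there are no loops; parallel edges are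
  repeated members of the multiset of edges.
\<close>

locale special_multigraph =
  fixes V :: "'a set" and E :: "'a set multiset" and S :: "'a set"
  assumes finite_vertices: "finite V"
    and edges: "e \<in># E \<Longrightarrow> \<exists>u\<in>V. \<exists>v\<in>V. u \<noteq> v \<and> e = {u, v}"
    and special_vertices: "S \<subseteq> V"

definition edges_within :: "'a set multiset \<Rightarrow> 'a set \<Rightarrow> nat" where
  "edges_within E W = size {#e \<in># E. e \<subseteq> W#}"

definition specials_within :: "'a set \<Rightarrow> 'a set \<Rightarrow> nat" where
  "specials_within S W = card (W \<inter> S)"

end

theory Submission
  imports Defs
begin

text \<open>
  Choose \<open>W \<subseteq> V\<close> minimising \<open>e(W) + e(V - W) + 3 D\<^sup>2 / (4 k)\<close>, where \<open>D = f(W) - f(V - W)\<close>.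
  Summing over \<open>v \<in> W\<close> the inequality that says that moving \<open>v\<close> to the other side does not decrease
  this quantity gives \<open>3 e(W) \<le> m + 3 f(W) (1 - D) / k\<close>. Since \<open>2 f(W) - k = D\<close> and
  \<open>D (1 - D) \<le> 0\<close> for every integer \<open>D\<close>, the right-hand side is at most \<open>m + 3 (1 - D) / 2\<close>, which
  is the bound for \<open>W\<close>. The minimised quantity is symmetric in \<open>W\<close> and \<open>V - W\<close>, so the bound holds
  for both sides. For \<open>k = 0\<close> the quadratic term is read as \<open>0\<close>, which is what \<open>x / 0 = 0\<close> yields.
\<close>

lemma edges_within_empty [simp]: "edges_within {#} W = 0"
  by (simp add: edges_within_def)

lemma edges_within_add_mset:
  "edges_within (add_mset e E) W = of_bool (e \<subseteq> W) + edges_within E W"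
  by (simp add: edges_within_def)

text \<open>Check by the number of ends of the edge in \<open>W\<close>. With two, moving either end
  destroys it, giving -2; with one, moving that end puts the edge inside \<open>V - W\<close>,
  giving 1; with none, no move affects it, giving 0.\<close>

lemma sum_edge_move:
  fixes V W :: "'a set"
  assumes "finite V" "W \<subseteq> V" "a \<in> V" "b \<in> V" "a \<noteq> b"
  shows "(\<Sum>v\<in>W. (of_bool ({a, b} \<subseteq> W - {v}) + of_bool ({a, b} \<subseteq> insert v (V - W))
      - of_bool ({a, b} \<subseteq> W) - of_bool ({a, b} \<subseteq> V - W) :: real))
    = 1 - 3 * of_bool ({a, b} \<subseteq> W) - of_bool ({a, b} \<subseteq> V - W)"
    (is "sum ?g W = _")
proof -
  \<comment> \<open>\<open>\<alpha>\<close> is the effect of moving \<open>a\<close> and depends on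
    the side of the other end \<open>b\<close>; \<open>\<beta>\<close> is the same for
    \<open>b\<close>. Only these two vertices contribute to the sum.\<close>
  define \<alpha> \<beta> :: real where "\<alpha> = (if b \<in> W then - 1 else 1)" and "\<beta> = (if a \<in> W then - 1 else 1)"
  have fin: "finite W"
    using assms(1,2) finite_subset by blast
  have "sum ?g W = (\<Sum>v\<in>W. (if v = a then \<alpha> else 0) + (if v = b then \<beta> else 0))"
    by (rule sum.cong) (use assms in \<open>auto simp: \<alpha>_def \<beta>_def\<close>)
  also have "\<dots> = (if a \<in> W then \<alpha> else 0) + (if b \<in> W then \<beta> else 0)"
    by (simp add: sum.distrib sum.delta fin)
  finally show ?thesis
    using assms by (auto simp: \<alpha>_def \<beta>_def)
qed

text \<open>Both sides are additive over the edges, so this is \<open>sum_edge_move\<close> added up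
  with multiplicity.\<close>

lemma sum_edges_within_move:
  fixes V W :: "'a set"
  assumes "finite V" "W \<subseteq> V" "\<And>e. e \<in># E \<Longrightarrow> \<exists>u\<in>V. \<exists>v\<in>V. u \<noteq> v \<and> e = {u, v}"
  shows "(\<Sum>v\<in>W. real (edges_within E (W - {v})) + real (edges_within E (insert v (V - W)))
      - real (edges_within E W) - real (edges_within E (V - W)))
    = real (size E) - 3 * real (edges_within E W) - real (edges_within E (V - W))"
  using assms(3)
proof (induction E)
  case empty
  show ?case by simp
next
  case (add e E)
  obtain a b where ab: "a \<in> V" "b \<in> V" "a \<noteq> b" and e: "e = {a, b}"
    using add.prems[of e] by auto
  have IH: "(\<Sum>v\<in>W. real (edges_within E (W - {v})) + real (edges_within E (insert v (V - W)))
      - real (edges_within E W) - real (edges_within E (V - W)))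
    = real (size E) - 3 * real (edges_within E W) - real (edges_within E (V - W))"
    by (rule add.IH) (use add.prems in auto)
  have "(\<Sum>v\<in>W. real (edges_within (add_mset e E) (W - {v}))
        + real (edges_within (add_mset e E) (insert v (V - W)))
        - real (edges_within (add_mset e E) W) - real (edges_within (add_mset e E) (V - W)))
    = (\<Sum>v\<in>W. (of_bool (e \<subseteq> W - {v}) + of_bool (e \<subseteq> insert v (V - W))
          - of_bool (e \<subseteq> W) - of_bool (e \<subseteq> V - W))
        + (real (edges_within E (W - {v})) + real (edges_within E (insert v (V - W)))
          - real (edges_within E W) - real (edges_within E (V - W))))"
    by (rule sum.cong) (simp_all add: edges_within_add_mset)
  also have "\<dots> = 1 - 3 * of_bool (e \<subseteq> W) - of_bool (e \<subseteq> V - W)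
    + (real (size E) - 3 * real (edges_within E W) - real (edges_within E (V - W)))"
    unfolding sum.distrib IH e by (subst sum_edge_move) (use assms ab in auto)
  finally show ?case
    by (simp add: edges_within_add_mset)
qed

text \<open>Integer-valued on purpose: the final estimate fails for real values strictly between 0
  and 1.\<close>

definition imbalance :: "'a set \<Rightarrow> 'a set \<Rightarrow> 'a set \<Rightarrow> int" where
  "imbalance V S W = int (specials_within S W) - int (specials_within S (V - W))"

lemma imbalance_eq:
  assumes "finite V" "S \<subseteq> V" "W \<subseteq> V"
  shows "imbalance V S W = 2 * int (specials_within S W) - int (card S)"
proof -
  have "finite S"
    using assms finite_subset by blast
  moreover have "S = (W \<inter> S) \<union> ((V - W) \<inter> S)"
    using assms by blast
  ultimately have "card S = card (W \<inter> S) + card ((V - W) \<inter> S)"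
    using card_Un_disjoint[of "W \<inter> S" "(V - W) \<inter> S"] by auto
  then show ?thesis
    by (simp add: imbalance_def specials_within_def)
qed

lemma imbalance_compl:
  assumes "W \<subseteq> V"
  shows "imbalance V S (V - W) = - imbalance V S W"
  using assms by (simp add: imbalance_def double_diff)

lemma imbalance_remove:
  assumes "finite V" "S \<subseteq> V" "W \<subseteq> V" "v \<in> W"
  shows "imbalance V S (W - {v}) = imbalance V S W - 2 * of_bool (v \<in> S)"
proof -
  have fin: "finite (W \<inter> S)"
    using assms finite_subset by blast
  have "specials_within S W = specials_within S (W - {v}) + of_bool (v \<in> S)"
  proof (cases "v \<in> S")
    case True
    then have "card (W \<inter> S) = Suc (card (W \<inter> S - {v}))"
      using card_Suc_Diff1[OF fin, of v] assms by simp
    then show ?thesis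
      using True by (simp add: specials_within_def Diff_Int_distrib2 Int_Diff Int_commute)
  next
    case False
    then have "(W - {v}) \<inter> S = W \<inter> S" by blast
    then show ?thesis using False by (simp add: specials_within_def)
  qed
  then show ?thesis
    using assms by (subst (1 2) imbalance_eq) auto
qed

definition energy :: "'a set \<Rightarrow> 'a set multiset \<Rightarrow> 'a set \<Rightarrow> 'a set \<Rightarrow> real" where
  "energy V E S W = real (edges_within E W) + real (edges_within E (V - W))
    + 3 / (4 * real (card S)) * (real_of_int (imbalance V S W))\<^sup>2"

lemma energy_compl:
  assumes "W \<subseteq> V"
  shows "energy V E S (V - W) = energy V E S W"
  using assms by (simp add: energy_def imbalance_compl double_diff)

lemma (in special_multigraph) bound_of_energy_minimal:
  assumes W: "W \<subseteq> V"
    and min: "\<And>U. U \<subseteq> V \<Longrightarrow> energy V E S W \<le> energy V E S U"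
  shows "real (edges_within E W) + real (specials_within S W)
    \<le> real (size E) / 3 + (real (card S) + 1) / 2"
proof -
  define k where "k = real (card S)"
  define f where "f = real (specials_within S W)"
  define D where "D = imbalance V S W"
  define c where "c = 3 / (4 * k)"
  have fin: "finite W"
    using W finite_vertices finite_subset by blast
  have D: "real_of_int D = 2 * f - k"
    by (simp add: D_def f_def k_def imbalance_eq finite_vertices special_vertices W)
  \<comment> \<open>Moving a special vertex turns \<open>D\<close> into \<open>D - 2\<close>, and
    \<open>(D - 2)\<^sup>2 - D\<^sup>2 = 4 * (1 - D)\<close>.\<close>
  have step: "0 \<le> real (edges_within E (W - {v})) + real (edges_within E (insert v (V - W)))
      - real (edges_within E W) - real (edges_within E (V - W))
      + of_bool (v \<in> S) * (4 * c * (1 - D))" if "v \<in> W" for v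
  proof -
    have "V - (W - {v}) = insert v (V - W)"
      using that W by auto
    moreover have "energy V E S W \<le> energy V E S (W - {v})"
      using min W by blast
    ultimately show ?thesis
      using imbalance_remove[OF finite_vertices special_vertices W that]
      by (auto simp: energy_def c_def k_def D_def power2_eq_square algebra_simps diff_divide_distrib
          split: if_splits)
  qed
  have "(\<Sum>v\<in>W. of_bool (v \<in> S) * (4 * c * (1 - D))) = f * (4 * c * (1 - D))"
    using fin by (simp add: sum_distrib_right[symmetric] f_def specials_within_def
        of_bool_def sum.If_cases Int_def)
  moreover have "0 \<le> (\<Sum>v\<in>W. real (edges_within E (W - {v}))
      + real (edges_within E (insert v (V - W)))
      - real (edges_within E W) - real (edges_within E (V - W))
      + of_bool (v \<in> S) * (4 * c * (1 - D)))"
    by (rule sum_nonneg) (rule step)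
  ultimately have "0 \<le> real (size E) - 3 * real (edges_within E W)
      - real (edges_within E (V - W)) + f * (4 * c * (1 - D))"
    by (subst (asm) sum.distrib)
      (simp add: sum_edges_within_move[OF finite_vertices W edges])
  \<comment> \<open>The nonnegative term for \<open>V - W\<close> is dropped.\<close>
  then have bound: "3 * real (edges_within E W) \<le> real (size E) + 4 * c * f * (1 - D)"
    by (simp add: mult_ac)
  have "4 * c * f * (1 - D) \<le> 3 / 2 * (1 - D)"
  proof (cases "k = 0")
    \<comment> \<open>Here \<open>c = 0\<close> by division by zero and \<open>D = 0\<close>, so the
      claim reads \<open>0 \<le> 3 / 2\<close>.\<close>
    case True
    then have "S = {}"
      using finite_subset[OF special_vertices finite_vertices] by (simp add: k_def)
    then have "D = 0"
      by (simp add: D_def imbalance_def specials_within_def)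
    then show ?thesis
      using True by (simp add: c_def)
  next
    case False
    then have "k > 0" by (simp add: k_def)
    \<comment> \<open>An integer is at most 0 or at least 1, so the factors never have the same
      strict sign.\<close>
    have "D * (1 - D) \<le> 0"
      by (cases "D \<le> 0") (simp_all add: mult_nonpos_nonneg mult_nonneg_nonpos)
    then have "real_of_int D * (1 - real_of_int D) \<le> 0"
      by (metis of_int_1 of_int_diff of_int_le_0_iff of_int_mult)
    \<comment> \<open>Since \<open>2 * f = k + D\<close>, the two sides differ by exactly
      \<open>D * (1 - D)\<close>. The factor 3/4 in \<open>c\<close> makes this the required
      estimate after division by \<open>k\<close>.\<close>
    then have "2 * f * (1 - D) \<le> k * (1 - D)"
      by (simp add: D algebra_simps)
    then show ?thesis
      using \<open>k > 0\<close> by (simp add: c_def field_simps)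
  qed
  with bound have "3 * real (edges_within E W) \<le> real (size E) + 3 / 2 * (1 - D)"
    by linarith
  then show ?thesis
    \<comment> \<open>Substituting \<open>D = 2 * f - k\<close> turns \<open>3 / 2 * (1 - D)\<close>
      into \<open>3 / 2 * (k + 1) - 3 * f\<close>; dividing by 3 gives the claim.\<close>
    unfolding f_def[symmetric] k_def[symmetric] by (simp add: D field_simps)
qed

theorem theorem2:
  fixes V :: "'a set" and E :: "'a set multiset" and S :: "'a set" and m k :: nat
  assumes "special_multigraph V E S"
    and "size E = m"
    and "card S = k"
  shows "\<exists>V1 V2. V = V1 \<union> V2 \<and> V1 \<inter> V2 = {} \<and>
    (\<forall>W\<in>{V1, V2}.
      real (edges_within E W) + real (specials_within S W) \<le> real m / 3 + (real k + 1) / 2)"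
proof -
  interpret special_multigraph V E S by fact
  have "\<exists>W\<in>Pow V. \<forall>U\<in>Pow V. energy V E S W \<le> energy V E S U"
    by (rule ex_is_arg_min_if_finite[of "Pow V" "energy V E S",
          unfolded is_arg_min_linorder, THEN exE])
      (use finite_vertices in auto)
  then obtain W where W: "W \<subseteq> V"
    and min: "\<And>U. U \<subseteq> V \<Longrightarrow> energy V E S W \<le> energy V E S U"
    by blast
  have "\<forall>X\<in>{W, V - W}.
      real (edges_within E X) + real (specials_within S X) \<le> real m / 3 + (real k + 1) / 2"
    using bound_of_energy_minimal[of W] bound_of_energy_minimal[of "V - W"] W min assms(2,3)
    by (simp add: energy_compl)
  then show ?thesis
    using W by (intro exI[of _ W] exI[of _ "V - W"]) auto
qed

end
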